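(* For every $v_0\in\mathbb{R}^n$ there exists a unique sequence $\{v_k\}_{k=0}^\infty$ satisfying the iteration of Semismooth Newton Method III (SNMIII), namely $$v_{k+1}=T^{v_k}_{\pi_{k+1}}v_{k+1},\qquad\text{where } \pi_{k+1}\in\Pi \text{ is such that } D_{\pi_{k+1}}v_k=Dv_k,\qquad k\ge 0 .$$ Moreover, if $\chi:\mathbb{R}^n\times\mathbb{S}^n\to\mathbb{R}$ is piecewise continuously differentiable of order 1 in the first argument, then there exists a neighborhood $\mathcal{U}_{v^*}\subseteq\mathbb{R}^n$ of $v^*$ such that, for all $v_0\in\mathcal{U}_{v^*}$, the sequence converges Q-superlinearly to $v^*$.
   Context: Setting. $\mathcal{S}=\{1,\dots,n\}$ and $\mathcal{A}=\{1,\dots,m\}$ are finite state and action sets, $\mathcal{A}(i)\subseteq\mathcal{A}$ is the nonempty set of actions allowed in state $i$, $\gamma\in(0,1)$ is the discount factor, $\mathbb{S}^n$ is the probability simplex in $\mathbb{R}^n$, $P:\mathcal{S}\times\mathcal{A}\to\mathbb{S}^n$ is the controlled kernel and $g:\mathcal{S}\times\mathcal{A}\to[-R,R]$, $R>0$, is the stage cost. $\Pi$ is the finite set of policies $\pi:\mathcal{S}\to\mathcal{A}$ with $\pi(i)\in\mathcal{A}(i)$ for all $i$; $g_\pi\in\mathbb{R}^n$ has entries $g(i,\pi(i))$. $\chi:\mathbb{R}^n\times\mathbb{S}^n\to\mathbb{R}$ is the risk-transition mapping of a stationary Markov coherent risk measure $\mu$, that is, $\mu(v(s_{t+1}))=\chi(v,P(s_t,a_t))$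 for all $v\in\mathbb{R}^n$ and allowed actions $a_t$, where $s_t,a_t$ are the state and action at time $t$. It satisfies: for every $(i,a)\in\mathcal{S}\times\mathcal{A}$ there is a nonempty compact convex set $\mathcal{P}_\chi(P(i,a))\subset\mathbb{S}^n$ such that $\chi(v,P(i,a))=\max_{\tilde p\in\mathcal{P}_\chi(P(i,a))}\langle v,\tilde p\rangle$ for all $v\in\mathbb{R}^n$. The risk-averse Bellman operators $D_\pi,D:\mathbb{R}^n\to\mathbb{R}^n$ are $(D_\pi v)(i)=g(i,\pi(i))+\gamma\,\chi(v,P(i,\pi(i)))$ for $\pi\in\Pi$, and $(Dv)(i)=\min_{a\in\mathcal{A}(i)}\{g(i,a)+\gamma\,\chi(v,P(i,a))\}$, $i\in\mathcal{S}$. $D$ is a $\gamma$-contraction in the infinity norm, and $v^*$ denotes its unique fixed point. For $\tilde v\in\mathbb{R}^n$ and $\pi\in\Pi$, $P^{\tilde v}_\pi$ is the row-stochastic $n\times n$ matrix whose $i$-th row satisfies $[P^{\tilde v}_\pi]_{i,:}\in\arg\max_{p\in\mathcal{P}_\chi(P(i,\pi(i)))}\langle p,\tilde v\rangle$ for each $i\in\mathcal{S}$, and $T^{\tilde v}_\pi:\mathbb{R}^n\to\mathbb{R}^n$ is $T^{\tilde v}_\pi v=g_\pi+\gamma P^{\tilde v}_\pi v$. SNMIII: starting from $v_0\in\mathbb{R}^n$, for $k=0,1,2,\dots$ compute $P^{v_k}_\pi$ for $\pi\in\Pi$, extract $\pi_{k+1}$ such that $D_{\pi_{k+1}}v_k=Dv_k$,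 and let $v_{k+1}$ solve the linear system $v_{k+1}=T^{v_k}_{\pi_{k+1}}v_{k+1}$. A function $f:\mathbb{R}^n\to\mathbb{R}$ is piecewise continuously differentiable of order 1 ($PC^1$) if it is continuous and every point has a neighborhood on which there are finitely many continuously differentiable functions $f_1,\dots,f_N$ with $f(x)\in\{f_1(x),\dots,f_N(x)\}$ for all $x$ in the neighborhood. The hypothesis on $\chi$ means that $v\mapsto\chi(v,p)$ is $PC^1$ for each fixed $p\in\mathbb{S}^n$. A sequence converges Q-superlinearly to $v^*$ if $v_k\to v^*$ and for every $\varepsilon>0$ one has $\Vert v_{k+1}-v^*\Vert\le\varepsilon\Vert v_k-v^*\Vert$ for all sufficiently large $k$.
   Formalization: Several policies may satisfy the condition on π_{k+1} and give different v_{k+1}, so literal uniqueness fails; proved instead: a sequence exists, it is unique once a rule choosing π_{k+1} from k and v_k is fixed, and local Q-superlinear convergence holds for every choice. *)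

theory Defs
  imports "HOL-Analysis.Analysis"
begin

text \<open>
  States and actions are the elements of finite types \<open>'n\<close> and \<open>'m\<close>; \<open>adm i\<close> is the set of
  actions allowed in state \<open>i\<close>, \<open>P i a\<close> the transition distribution, \<open>g i a\<close> the stage cost,
  \<open>risk v p\<close> the risk-transition mapping and \<open>env p\<close> its dual set of distributions
  (risk envelope) at the distribution \<open>p\<close>.
\<close>

definition prob_simplex :: "(real ^ 'n) set" where
  "prob_simplex = {p. (\<forall>i. 0 \<le> p $ i) \<and> (\<Sum>i\<in>UNIV. p $ i) = 1}"

definition risk_envelope ::
  "(real ^ 'n \<Rightarrow> real ^ 'n \<Rightarrow> real) \<Rightarrow> real ^ 'n \<Rightarrow> (real ^ 'n) set \<Rightarrow> bool" where
  "risk_envelope risk p C \<longleftrightarrow>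
     C \<noteq> {} \<and> compact C \<and> convex C \<and> C \<subseteq> prob_simplex \<and>
     (\<forall>v. \<exists>q. is_arg_max (\<lambda>q. v \<bullet> q) (\<lambda>q. q \<in> C) q \<and> risk v p = v \<bullet> q)"

definition policies :: "('n \<Rightarrow> 'm set) \<Rightarrow> ('n \<Rightarrow> 'm) set" where
  "policies adm = {\<pi>. \<forall>i. \<pi> i \<in> adm i}"

definition policy_bellman ::
  "real \<Rightarrow> ('n \<Rightarrow> 'm \<Rightarrow> real ^ 'n) \<Rightarrow> ('n \<Rightarrow> 'm \<Rightarrow> real) \<Rightarrow> (real ^ 'n \<Rightarrow> real ^ 'n \<Rightarrow> real) \<Rightarrow>
     ('n \<Rightarrow> 'm) \<Rightarrow> real ^ 'n \<Rightarrow> real ^ 'n" where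
  "policy_bellman \<gamma> P g risk \<pi> v = (\<chi> i. g i (\<pi> i) + \<gamma> * risk v (P i (\<pi> i)))"

definition bellman ::
  "('n \<Rightarrow> 'm set) \<Rightarrow> real \<Rightarrow> ('n \<Rightarrow> 'm \<Rightarrow> real ^ 'n) \<Rightarrow> ('n \<Rightarrow> 'm \<Rightarrow> real) \<Rightarrow>
     (real ^ 'n \<Rightarrow> real ^ 'n \<Rightarrow> real) \<Rightarrow> real ^ 'n \<Rightarrow> real ^ 'n" where
  "bellman adm \<gamma> P g risk v = (\<chi> i. MIN a\<in>adm i. g i a + \<gamma> * risk v (P i a))"

text \<open>
  The description is meaningful because the Bellman operator is a contraction for the
  infinity norm, hence has exactly one fixed point, whenever \<open>0 < \<gamma> < 1\<close>, all \<open>adm i\<close> are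
  nonempty and all the maps \<open>\<lambda>v. risk v (P i a)\<close> have a risk envelope.
\<close>

definition optimal_value ::
  "('n \<Rightarrow> 'm set) \<Rightarrow> real \<Rightarrow> ('n \<Rightarrow> 'm \<Rightarrow> real ^ 'n) \<Rightarrow> ('n \<Rightarrow> 'm \<Rightarrow> real) \<Rightarrow>
     (real ^ 'n \<Rightarrow> real ^ 'n \<Rightarrow> real) \<Rightarrow> real ^ 'n" where
  "optimal_value adm \<gamma> P g risk = (THE v. bellman adm \<gamma> P g risk v = v)"

definition greedy_policies ::
  "('n \<Rightarrow> 'm set) \<Rightarrow> real \<Rightarrow> ('n \<Rightarrow> 'm \<Rightarrow> real ^ 'n) \<Rightarrow> ('n \<Rightarrow> 'm \<Rightarrow> real) \<Rightarrow>
     (real ^ 'n \<Rightarrow> real ^ 'n \<Rightarrow> real) \<Rightarrow> real ^ 'n \<Rightarrow> ('n \<Rightarrow> 'm) set" where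
  "greedy_policies adm \<gamma> P g risk v =
     {\<pi> \<in> policies adm. policy_bellman \<gamma> P g risk \<pi> v = bellman adm \<gamma> P g risk v}"

text \<open>
  \<open>Q v \<pi>\<close> is the matrix used at the point \<open>v\<close> for the policy \<open>\<pi>\<close>. Maximizers need not be unique,
  so \<open>Q\<close> is an arbitrary selection; its matrices are row-stochastic as soon as
  \<open>env (P i a) \<subseteq> prob_simplex\<close>.
\<close>

definition worst_case_selection ::
  "('n \<Rightarrow> 'm set) \<Rightarrow> ('n \<Rightarrow> 'm \<Rightarrow> real ^ 'n) \<Rightarrow> (real ^ 'n \<Rightarrow> (real ^ 'n) set) \<Rightarrow>
     (real ^ 'n \<Rightarrow> ('n \<Rightarrow> 'm) \<Rightarrow> real ^ 'n ^ 'n) \<Rightarrow> bool" where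
  "worst_case_selection adm P env Q \<longleftrightarrow>
     (\<forall>v. \<forall>\<pi>\<in>policies adm. \<forall>i.
        is_arg_max (\<lambda>p. p \<bullet> v) (\<lambda>p. p \<in> env (P i (\<pi> i))) (row i (Q v \<pi>)))"

definition linearized_operator ::
  "real \<Rightarrow> ('n \<Rightarrow> 'm \<Rightarrow> real) \<Rightarrow> (real ^ 'n \<Rightarrow> ('n \<Rightarrow> 'm) \<Rightarrow> real ^ 'n ^ 'n) \<Rightarrow>
     real ^ 'n \<Rightarrow> ('n \<Rightarrow> 'm) \<Rightarrow> real ^ 'n \<Rightarrow> real ^ 'n" where
  "linearized_operator \<gamma> g Q u \<pi> v = (\<chi> i. g i (\<pi> i)) + \<gamma> *\<^sub>R (Q u \<pi> *v v)"

text \<open>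
  Here \<open>pol k\<close> is the policy extracted at \<open>v k\<close>, i.e. the one usually denoted \<open>\<pi>\<close> with index
  \<open>k + 1\<close>.
\<close>

definition snm3 ::
  "('n \<Rightarrow> 'm set) \<Rightarrow> real \<Rightarrow> ('n \<Rightarrow> 'm \<Rightarrow> real ^ 'n) \<Rightarrow> ('n \<Rightarrow> 'm \<Rightarrow> real) \<Rightarrow>
     (real ^ 'n \<Rightarrow> real ^ 'n \<Rightarrow> real) \<Rightarrow> (real ^ 'n \<Rightarrow> ('n \<Rightarrow> 'm) \<Rightarrow> real ^ 'n ^ 'n) \<Rightarrow>
     (nat \<Rightarrow> 'n \<Rightarrow> 'm) \<Rightarrow> (nat \<Rightarrow> real ^ 'n) \<Rightarrow> bool" where
  "snm3 adm \<gamma> P g risk Q pol v \<longleftrightarrow>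
     (\<forall>k. pol k \<in> greedy_policies adm \<gamma> P g risk (v k) \<and>
          v (Suc k) = linearized_operator \<gamma> g Q (v k) (pol k) (v (Suc k)))"

definition continuously_differentiable_on ::
  "('a::real_normed_vector \<Rightarrow> 'b::real_normed_vector) \<Rightarrow> 'a set \<Rightarrow> bool" where
  "continuously_differentiable_on f U \<longleftrightarrow>
     (\<exists>f' :: 'a \<Rightarrow> 'a \<Rightarrow>\<^sub>L 'b.
        (\<forall>x\<in>U. (f has_derivative blinfun_apply (f' x)) (at x)) \<and> continuous_on U f')"

definition PC1 :: "('a::real_normed_vector \<Rightarrow> 'b::real_normed_vector) \<Rightarrow> bool" where
  "PC1 f \<longleftrightarrow> continuous_on UNIV f \<and>
     (\<forall>x. \<exists>U F. open U \<and> x \<in> U \<and> finite F \<and>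
        (\<forall>h\<in>F. continuously_differentiable_on h U) \<and>
        (\<forall>y\<in>U. f y \<in> (\<lambda>h. h y) ` F))"

definition Q_superlinear :: "(nat \<Rightarrow> 'a::real_normed_vector) \<Rightarrow> 'a \<Rightarrow> bool" where
  "Q_superlinear v l \<longleftrightarrow> v \<longlonglongrightarrow> l \<and>
     (\<forall>\<epsilon>>0. \<forall>\<^sub>F k in sequentially. norm (v (Suc k) - l) \<le> \<epsilon> * norm (v k - l))"

end

theory Submission imports Defs begin

text \<open>
  Each map \<open>v \<mapsto> risk v p\<close>, \<open>p = P i a\<close>, is the support function of a compact set of probability vectors,
  so it is nonexpansive for the infinity norm, and a maximizer \<open>q\<close> at \<open>v\<close> yields a linear function
  \<open>w \<mapsto> w \<bullet> q\<close> that agrees with it at \<open>v\<close> and lies below it everywhere. Superlinear convergence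
  rests on the fact that this function, chosen at \<open>v\<close>, is correct at a given point \<open>w\<close> up to
  \<open>o(norm (v - w))\<close> (\<open>risk_linearization_error\<close>); this is the semismoothness of support functions.
  The reason is compactness: as \<open>v\<close> tends to \<open>w\<close>, a maximizer \<open>q\<close> at \<open>v\<close> comes close to the set of
  maximizers at \<open>w\<close> (\<open>eventually_maximizer_near_maximizer\<close>). If \<open>q'\<close> is one of those at distance less
  than \<open>\<epsilon>\<close> from \<open>q\<close>, then \<open>v \<bullet> q' \<le> v \<bullet> q\<close> says precisely that the error \<open>w \<bullet> q' - w \<bullet> q\<close> is
  at most \<open>(v - w) \<bullet> (q - q')\<close>, hence at most \<open>\<epsilon> * norm (v - w)\<close>.

  There are finitely many actions and the action values are continuous, so an action that is not
  optimal at \<open>w\<close> is not optimal at nearby points either: greedy policies at \<open>v\<close> are greedy at \<open>w\<close>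
  (\<open>eventually_greedy_subset\<close>). Thus, with \<open>\<pi>\<close> greedy at \<open>v\<close>, the affine operator linearized at \<open>v\<close>
  and the Bellman operator differ at \<open>w\<close> by \<open>o(norm (v - w))\<close> only (\<open>linearized_operator_error\<close>).

  The fixed-point equation of the linearized operator is a system with matrix \<open>I - \<gamma> M\<close>, \<open>M\<close>
  stochastic. It has exactly one solution, which makes the iteration well defined, and the inverse
  has norm at most \<open>1 / (1 - \<gamma>)\<close> uniformly in \<open>M\<close> (\<open>discounted_stochastic_perturbation\<close>). For \<open>w\<close>
  the optimal value, which is a fixed point of the Bellman operator, this uniform bound turns the
  error of the operators at \<open>w\<close> into the same bound for the distance of the next iterate from \<open>w\<close>
  (\<open>newton_step_error\<close>). A ball on which one step halves the distance to \<open>w\<close> is then the required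
  neighborhood.
\<close>

section \<open>The infinity norm and stochastic matrices\<close>

lemma infnorm_le_cart:
  fixes x :: "real ^ 'n"
  assumes "\<And>i. \<bar>x $ i\<bar> \<le> B"
  shows "infnorm x \<le> B"
  unfolding infnorm_Max using assms
  by (auto simp: Basis_vec_def inner_axis intro!: Max.boundedI)

lemma continuous_on_if_infnorm_Lipschitz:
  fixes f :: "real ^ 'n::finite \<Rightarrow> 'b::real_normed_vector"
  assumes "\<And>v w. norm (f v - f w) \<le> c * infnorm (v - w)" "0 \<le> c"
  shows "continuous_on A f"
proof -
  have "norm (f v - f w) \<le> c * norm (v - w)" for v w
    using assms(1)[of v w] mult_left_mono[OF infnorm_le_norm[of "v - w"] assms(2)] by linarith
  then have "c-lipschitz_on A f" using assms(2) by (intro lipschitz_onI) (auto simp: dist_norm)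
  then show ?thesis by (rule lipschitz_on_continuous_on)
qed

lemma abs_inner_simplex_le:
  assumes "q \<in> prob_simplex"
  shows "\<bar>v \<bullet> q\<bar> \<le> infnorm v"
proof -
  have "\<bar>v \<bullet> q\<bar> \<le> (\<Sum>i\<in>UNIV. \<bar>v $ i * q $ i\<bar>)"
    by (simp add: inner_vec_def sum_abs)
  also have "\<dots> \<le> (\<Sum>i\<in>UNIV. infnorm v * q $ i)"
    using assms
    by (intro sum_mono) (auto simp: prob_simplex_def abs_mult intro!: mult_right_mono component_le_infnorm_cart)
  also have "\<dots> = infnorm v"
    using assms by (simp add: prob_simplex_def flip: sum_distrib_left)
  finally show ?thesis .
qed

lemma matrix_vector_mult_nth:
  fixes M :: "real ^ 'n ^ 'm"
  shows "(M *v x) $ i = x \<bullet> row i M"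
  by (simp add: matrix_vector_mult_def row_def inner_vec_def mult.commute)

lemma infnorm_stochastic_mult_le:
  assumes "\<And>i. row i M \<in> prob_simplex"
  shows "infnorm (M *v x) \<le> infnorm x"
proof (rule infnorm_le_cart)
  fix i
  show "\<bar>(M *v x) $ i\<bar> \<le> infnorm x"
    using abs_inner_simplex_le[OF assms] by (simp add: matrix_vector_mult_nth)
qed

text \<open>
  Subtracting \<open>w\<close> from the equation for \<open>x\<close> gives \<open>(I - \<gamma> M) (x - w)\<close> as the residual of \<open>w\<close>, and
  \<open>M\<close> does not increase the infinity norm. With residual zero this also gives uniqueness of \<open>x\<close>.
\<close>

lemma discounted_stochastic_perturbation:
  assumes "\<And>i. row i M \<in> prob_simplex" and "0 < \<gamma>"
    and x: "x = b + \<gamma> *\<^sub>R (M *v x)"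
  shows "(1 - \<gamma>) * infnorm (x - w) \<le> infnorm (b + \<gamma> *\<^sub>R (M *v w) - w)"
proof -
  have "x - w = (b + \<gamma> *\<^sub>R (M *v w) - w) + \<gamma> *\<^sub>R (M *v (x - w))"
    by (subst x) (simp add: matrix_vector_mult_diff_distrib scaleR_diff_right)
  then have "infnorm (x - w) \<le> infnorm (b + \<gamma> *\<^sub>R (M *v w) - w) + infnorm (\<gamma> *\<^sub>R (M *v (x - w)))"
    by (metis infnorm_triangle)
  moreover have "infnorm (\<gamma> *\<^sub>R (M *v (x - w))) \<le> \<gamma> * infnorm (x - w)"
    using infnorm_stochastic_mult_le[OF assms(1), of "x - w"] assms(2) by (simp add: infnorm_mul)
  ultimately show ?thesis by (simp add: algebra_simps)
qed

lemma discounted_stochastic_system_ex1: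
  fixes M :: "real ^ 'n ^ 'n"
  assumes M: "\<And>i. row i M \<in> prob_simplex" and \<gamma>: "0 < \<gamma>" "\<gamma> < 1"
  shows "\<exists>!x. x = b + \<gamma> *\<^sub>R (M *v x)"
proof -
  have unique: "x = y" if "x = b + \<gamma> *\<^sub>R (M *v x)" "y = b + \<gamma> *\<^sub>R (M *v y)" for x y b
  proof -
    have "(1 - \<gamma>) * infnorm (x - y) \<le> 0"
      using discounted_stochastic_perturbation[OF M \<gamma>(1) that(1), of y]
      unfolding that(2)[symmetric] diff_self infnorm_0 .
    then have "infnorm (x - y) \<le> 0"
      using \<gamma>(2) by (simp add: mult_le_0_iff)
    then show ?thesis by (metis antisym infnorm_eq_0 infnorm_pos_le right_minus_eq)
  qed
  let ?L = "\<lambda>x. x - \<gamma> *\<^sub>R (M *v x)"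
  have "linear ?L"
    using linear_compose[OF matrix_vector_mul_linear linear_scaleR]
    by (intro linear_compose_sub linear_ident) (simp add: o_def)
  moreover have "inj ?L"
  proof (rule injI)
    fix x y assume eq: "?L x = ?L y"
    have "x = ?L x + \<gamma> *\<^sub>R (M *v x)" by simp
    moreover have "y = ?L x + \<gamma> *\<^sub>R (M *v y)" unfolding eq by simp
    ultimately show "x = y" by (rule unique)
  qed
  ultimately have "surj ?L" by (rule linear_injective_imp_surjective[OF _ _ refl])
  then obtain x where "b = ?L x" unfolding surj_def by blast
  then have "x = b + \<gamma> *\<^sub>R (M *v x)" by (simp only: diff_add_cancel)
  then show ?thesis using unique by blast
qed

section \<open>Maximizers of linear forms over a compact set\<close>

text \<open>
  Upper semicontinuity of the set of maximizers. The points of \<open>C\<close> that stay \<open>\<epsilon>\<close>-away from all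
  maximizers at \<open>w\<close> form a compact set, so they miss the maximum at \<open>w\<close> by a positive margin; as
  \<open>C\<close> is bounded, a small change of \<open>w\<close> cannot use this margin up.
\<close>

lemma eventually_maximizer_near_maximizer:
  fixes C :: "'a::real_inner set"
  assumes "compact C" and "0 < \<epsilon>"
  shows "\<forall>\<^sub>F v in nhds w. \<forall>q. is_arg_max (\<lambda>q. v \<bullet> q) (\<lambda>q. q \<in> C) q \<longrightarrow>
           (\<exists>q'. is_arg_max (\<lambda>q. w \<bullet> q) (\<lambda>q. q \<in> C) q' \<and> norm (q - q') < \<epsilon>)"
proof -
  define F where "F = {q. is_arg_max (\<lambda>q. w \<bullet> q) (\<lambda>q. q \<in> C) q}"
  define K where "K = C \<inter> (\<Inter>q'\<in>F. {q. \<epsilon> \<le> norm (q - q')})"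
  \<comment> \<open>It suffices to exclude points of \<open>K\<close>, those far from all maximizers at \<open>w\<close>, as maximizers at \<open>v\<close>.\<close>
  have K_free: ?thesis if "\<forall>\<^sub>F v in nhds w. \<forall>q\<in>K. \<not> is_arg_max (\<lambda>q. v \<bullet> q) (\<lambda>q. q \<in> C) q"
    using that
  proof (rule eventually_mono, intro allI impI)
    fix v q
    assume "\<forall>q\<in>K. \<not> is_arg_max (\<lambda>q. v \<bullet> q) (\<lambda>q. q \<in> C) q"
      and q: "is_arg_max (\<lambda>q. v \<bullet> q) (\<lambda>q. q \<in> C) q"
    then have "q \<notin> K" by blast
    then show "\<exists>q'. is_arg_max (\<lambda>q. w \<bullet> q) (\<lambda>q. q \<in> C) q' \<and> norm (q - q') < \<epsilon>"
      using q unfolding K_def F_def is_arg_max_def by force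
  qed
  show ?thesis
  proof (cases "K = {}")
    case True
    then show ?thesis by (intro K_free) simp
  next
    case False
    have "compact K"
      unfolding K_def using assms(1)
      by (intro compact_Int_closed closed_INT ballI closed_Collect_le continuous_intros)
    moreover have "continuous_on K (\<lambda>q. w \<bullet> q)" by (intro continuous_intros)
    ultimately obtain q1 where q1: "q1 \<in> K" "\<And>q. q \<in> K \<Longrightarrow> w \<bullet> q \<le> w \<bullet> q1"
      using continuous_attains_sup[OF _ False] by blast
    have "q1 \<notin> F" using q1(1) assms(2) by (force simp: K_def)
    with q1(1) obtain q0 where q0: "q0 \<in> C" "w \<bullet> q1 < w \<bullet> q0"
      by (auto simp: F_def K_def is_arg_max_def)
    obtain b where b: "\<And>q. q \<in> C \<Longrightarrow> norm q \<le> b"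
      using compact_imp_bounded[OF assms(1)] by (auto simp: bounded_iff)
    have "((\<lambda>v. norm (v - w) * (2 * b)) \<longlongrightarrow> norm (w - w) * (2 * b)) (nhds w)"
      by (intro tendsto_intros filterlim_ident)
    then have "\<forall>\<^sub>F v in nhds w. norm (v - w) * (2 * b) < w \<bullet> q0 - w \<bullet> q1"
      by (rule order_tendstoD(2)) (use q0(2) in simp)
    then show ?thesis
    proof (intro K_free, elim eventually_mono, intro ballI notI)
      fix v q
      assume v: "norm (v - w) * (2 * b) < w \<bullet> q0 - w \<bullet> q1" and q: "q \<in> K"
        and "is_arg_max (\<lambda>q. v \<bullet> q) (\<lambda>q. q \<in> C) q"
      then have "v \<bullet> q0 \<le> v \<bullet> q" using q0(1) by (simp add: is_arg_max_linorder)
      moreover have "(v - w) \<bullet> (q - q0) \<le> norm (v - w) * (2 * b)"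
      proof -
        have "norm (q - q0) \<le> 2 * b"
          using b[of q] b[OF q0(1)] q norm_triangle_ineq4[of q q0] by (simp add: K_def)
        then have "norm (v - w) * norm (q - q0) \<le> norm (v - w) * (2 * b)"
          by (simp add: mult_left_mono)
        then show ?thesis using norm_cauchy_schwarz order_trans by blast
      qed
      moreover have "w \<bullet> q \<le> w \<bullet> q1" using q1(2) q by blast
      ultimately show False using v by (simp add: inner_diff_left inner_diff_right)
    qed
  qed
qed

section \<open>Risk mappings as support functions\<close>

lemma risk_eq_inner_maximizer:
  assumes "risk_envelope risk p C" and "is_arg_max (\<lambda>q. v \<bullet> q) (\<lambda>q. q \<in> C) q"
  shows "risk v p = v \<bullet> q"
proof -
  obtain q' where q': "is_arg_max (\<lambda>q. v \<bullet> q) (\<lambda>q. q \<in> C) q'" "risk v p = v \<bullet> q'"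
    using assms(1) unfolding risk_envelope_def by blast
  then have "v \<bullet> q' = v \<bullet> q"
    using assms(2) unfolding is_arg_max_linorder by (metis antisym)
  then show ?thesis using q'(2) by simp
qed

lemma inner_le_risk:
  assumes "risk_envelope risk p C" and "q \<in> C"
  shows "v \<bullet> q \<le> risk v p"
proof -
  obtain q' where "is_arg_max (\<lambda>q. v \<bullet> q) (\<lambda>q. q \<in> C) q'" and "risk v p = v \<bullet> q'"
    using assms(1) unfolding risk_envelope_def by blast
  then show ?thesis using assms(2) by (simp add: is_arg_max_linorder)
qed

lemma risk_eq_inner:
  assumes "risk_envelope risk p C"
  obtains q where "q \<in> C" and "q \<in> prob_simplex" and "risk v p = v \<bullet> q"
proof -
  obtain q where q: "is_arg_max (\<lambda>q. v \<bullet> q) (\<lambda>q. q \<in> C) q" "risk v p = v \<bullet> q"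
    using assms unfolding risk_envelope_def by blast
  moreover have "q \<in> C" using q(1) by (simp add: is_arg_max_def)
  moreover have "C \<subseteq> prob_simplex" using assms by (simp add: risk_envelope_def)
  ultimately show ?thesis using that by blast
qed

lemma risk_nonexpansive:
  assumes "risk_envelope risk p C"
  shows "\<bar>risk v p - risk w p\<bar> \<le> infnorm (v - w)"
proof -
  have le: "risk v p - risk w p \<le> infnorm (v - w)" for v w
  proof -
    obtain q where q: "q \<in> C" "q \<in> prob_simplex" "risk v p = v \<bullet> q"
      using risk_eq_inner[OF assms] .
    have "risk v p - risk w p \<le> (v - w) \<bullet> q"
      using inner_le_risk[OF assms q(1), of w] q(3) by (simp add: inner_diff_left)
    also have "\<dots> \<le> infnorm (v - w)" using abs_inner_simplex_le[OF q(2), of "v - w"] by linarith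
    finally show ?thesis .
  qed
  show ?thesis using le[of v w] le[of w v] by (simp add: abs_le_iff infnorm_sub)
qed

text \<open>
  The loss at \<open>w\<close> of using a maximizer \<open>q\<close> for \<open>v\<close> is of smaller order than
  \<open>norm (v - w)\<close>: it is at most
  \<open>(v - w) \<bullet> (q - q')\<close> for each maximizer \<open>q'\<close> at \<open>w\<close>, and \<open>q'\<close> can be chosen close to \<open>q\<close>.
\<close>

lemma risk_linearization_error:
  assumes "risk_envelope risk p C" and "0 < \<epsilon>"
  shows "\<forall>\<^sub>F v in nhds w. \<forall>q. is_arg_max (\<lambda>q. v \<bullet> q) (\<lambda>q. q \<in> C) q \<longrightarrow>
           risk w p - w \<bullet> q \<le> \<epsilon> * norm (v - w)"
proof -
  have "compact C" using assms(1) by (simp add: risk_envelope_def)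
  from eventually_maximizer_near_maximizer[OF this assms(2)] show ?thesis
  proof (rule eventually_mono, intro allI impI)
    fix v q
    assume near: "\<forall>q. is_arg_max (\<lambda>q. v \<bullet> q) (\<lambda>q. q \<in> C) q \<longrightarrow>
      (\<exists>q'. is_arg_max (\<lambda>q. w \<bullet> q) (\<lambda>q. q \<in> C) q' \<and> norm (q - q') < \<epsilon>)"
      and q: "is_arg_max (\<lambda>q. v \<bullet> q) (\<lambda>q. q \<in> C) q"
    then obtain q' where q': "is_arg_max (\<lambda>q. w \<bullet> q) (\<lambda>q. q \<in> C) q'" "norm (q - q') < \<epsilon>"
      by blast
    have "v \<bullet> q' \<le> v \<bullet> q" using q q'(1) by (simp add: is_arg_max_linorder)
    then have "risk w p - w \<bullet> q \<le> (v - w) \<bullet> (q - q')"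
      using risk_eq_inner_maximizer[OF assms(1) q'(1)] by (simp add: inner_diff_left inner_diff_right)
    also have "\<dots> \<le> norm (v - w) * norm (q - q')" by (rule norm_cauchy_schwarz)
    also have "\<dots> \<le> norm (v - w) * \<epsilon>" using q'(2) by (intro mult_left_mono) auto
    finally show "risk w p - w \<bullet> q \<le> \<epsilon> * norm (v - w)" by (simp add: mult.commute)
  qed
qed

section \<open>The risk-averse Bellman operator\<close>

locale risk_averse_mdp =
  fixes adm :: "'n::finite \<Rightarrow> 'm::finite set"
    and \<gamma> R :: real
    and P :: "'n \<Rightarrow> 'm \<Rightarrow> real ^ 'n"
    and g :: "'n \<Rightarrow> 'm \<Rightarrow> real"
    and risk :: "real ^ 'n \<Rightarrow> real ^ 'n \<Rightarrow> real"
    and env :: "real ^ 'n \<Rightarrow> (real ^ 'n) set"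
  assumes adm_nonempty: "adm i \<noteq> {}"
    and discount: "0 < \<gamma>" "\<gamma> < 1"
    and cost_bound: "\<bar>g i a\<bar> \<le> R"
    and envelope: "risk_envelope risk (P i a) (env (P i a))"
begin

abbreviation D where "D \<equiv> bellman adm \<gamma> P g risk"
abbreviation greedy where "greedy \<equiv> greedy_policies adm \<gamma> P g risk"

definition action_value :: "real ^ 'n \<Rightarrow> 'n \<Rightarrow> 'm \<Rightarrow> real" where
  "action_value v i a = g i a + \<gamma> * risk v (P i a)"

lemma action_value_nonexpansive:
  "\<bar>action_value v i a - action_value w i a\<bar> \<le> \<gamma> * infnorm (v - w)"
proof -
  have "\<bar>action_value v i a - action_value w i a\<bar> = \<gamma> * \<bar>risk v (P i a) - risk w (P i a)\<bar>"
    using discount unfolding action_value_def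
    by (simp add: abs_mult_pos' right_diff_distrib)
  also have "\<dots> \<le> \<gamma> * infnorm (v - w)"
    using discount risk_nonexpansive[OF envelope] by (intro mult_left_mono) auto
  finally show ?thesis .
qed

lemma bellman_le: "a \<in> adm i \<Longrightarrow> D v $ i \<le> action_value v i a"
  by (simp add: bellman_def action_value_def)

lemma bellman_attained:
  obtains a where "a \<in> adm i" and "D v $ i = action_value v i a"
proof -
  have "D v $ i \<in> action_value v i ` adm i"
    unfolding bellman_def action_value_def vec_lambda_beta
    using adm_nonempty by (intro Min_in) auto
  then show ?thesis using that by blast
qed

lemma greedy_iff:
  "\<pi> \<in> greedy v \<longleftrightarrow> \<pi> \<in> policies adm \<and> (\<forall>i. action_value v i (\<pi> i) = D v $ i)"
  by (simp add: greedy_policies_def policy_bellman_def vec_eq_iff action_value_def)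

lemma greedy_nonempty: "greedy v \<noteq> {}"
proof -
  have "\<forall>i. \<exists>a. a \<in> adm i \<and> action_value v i a = D v $ i" by (metis bellman_attained)
  then obtain \<pi> where "\<forall>i. \<pi> i \<in> adm i \<and> action_value v i (\<pi> i) = D v $ i" by metis
  then have "\<pi> \<in> greedy v" by (simp add: greedy_iff policies_def)
  then show ?thesis by blast
qed

lemma bellman_contraction: "infnorm (D v - D w) \<le> \<gamma> * infnorm (v - w)"
proof -
  have le: "D v $ i - D w $ i \<le> \<gamma> * infnorm (v - w)" for v w i
  proof -
    obtain a where a: "a \<in> adm i" "D w $ i = action_value w i a" by (rule bellman_attained)
    then show ?thesis using bellman_le[OF a(1), of v] action_value_nonexpansive[of v i a w] by linarith
  qed
  show ?thesis
  proof (rule infnorm_le_cart)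
    fix i show "\<bar>(D v - D w) $ i\<bar> \<le> \<gamma> * infnorm (v - w)"
      using le[of v i w] le[of w i v] by (simp add: abs_le_iff infnorm_sub)
  qed
qed

lemma continuous_on_action_value: "continuous_on A (\<lambda>v. action_value v i a)"
  using action_value_nonexpansive discount
  by (intro continuous_on_if_infnorm_Lipschitz[where c = \<gamma>]) auto

lemma continuous_on_bellman: "continuous_on A D"
proof -
  have "\<bar>D v $ i - D w $ i\<bar> \<le> \<gamma> * infnorm (v - w)" for v w i
    using component_le_infnorm_cart[of "D v - D w" i] bellman_contraction[of v w] by simp
  then have "continuous_on A (\<lambda>v. \<chi> i. D v $ i)"
    using discount
    by (intro continuous_on_vec_lambda continuous_on_if_infnorm_Lipschitz[where c = \<gamma>]) auto
  then show ?thesis by simp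
qed

text \<open>
  The contraction property is for the infinity norm, whereas the metric of the type is the Euclidean
  one, for which the Bellman operator need not be a contraction. Existence is therefore taken from
  Brouwer's theorem: since the costs are bounded by \<open>R\<close>, the operator maps the box of radius
  \<open>R / (1 - \<gamma>)\<close> into itself. Uniqueness is the contraction property.
\<close>

lemma bellman_fixed_point_ex1: "\<exists>!v. D v = v"
proof -
  define r where "r = R / (1 - \<gamma>)"
  let ?B = "cbox (\<chi> i. - r) (\<chi> i. r) :: (real ^ 'n) set"
  have B_iff: "v \<in> ?B \<longleftrightarrow> (\<forall>i. \<bar>v $ i\<bar> \<le> r)" for v
    by (auto simp: mem_box_cart abs_le_iff) (metis minus_le_iff)+
  have r: "R + \<gamma> * r = r" using discount by (simp add: r_def field_simps)
  have "0 \<le> R" using cost_bound[of undefined undefined] by linarith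
  then have "0 \<le> r" using discount by (simp add: r_def)
  have "D v \<in> ?B" if "v \<in> ?B" for v
    unfolding B_iff
  proof
    fix i
    obtain a where a: "D v $ i = action_value v i a" by (rule bellman_attained)
    obtain q where q: "q \<in> prob_simplex" "risk v (P i a) = v \<bullet> q"
      using risk_eq_inner[OF envelope] by metis
    have "infnorm v \<le> r" using that by (intro infnorm_le_cart) (simp add: B_iff)
    then have "\<bar>risk v (P i a)\<bar> \<le> r" using abs_inner_simplex_le[OF q(1), of v] q(2) by simp
    then have "\<bar>\<gamma> * risk v (P i a)\<bar> \<le> \<gamma> * r"
      using discount by (simp add: abs_mult)
    then show "\<bar>D v $ i\<bar> \<le> r"
      using cost_bound[of i a] r by (simp add: a action_value_def)
  qed
  moreover have "0 \<in> ?B" using \<open>0 \<le> r\<close> by (simp add: B_iff)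
  ultimately obtain v where v: "D v = v"
    using brouwer[of ?B D] continuous_on_bellman
    by (metis Pi_I compact_cbox convex_box(1) empty_iff)
  have "w = v" if "D w = w" for w
  proof -
    have "infnorm (w - v) \<le> \<gamma> * infnorm (w - v)" using bellman_contraction[of w v] that v by simp
    then have "(1 - \<gamma>) * infnorm (w - v) \<le> 0" by (simp add: algebra_simps)
    then have "infnorm (w - v) \<le> 0" using discount by (simp add: mult_le_0_iff)
    then show ?thesis by (metis antisym infnorm_eq_0 infnorm_pos_le right_minus_eq)
  qed
  with v show ?thesis by blast
qed

abbreviation v_opt where "v_opt \<equiv> optimal_value adm \<gamma> P g risk"

lemma bellman_optimal_value: "D v_opt = v_opt"
  unfolding optimal_value_def by (rule theI'[OF bellman_fixed_point_ex1])

text \<open>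
  The gap between the value of an action that is not optimal at \<open>w\<close> and the minimum is continuous,
  hence stays positive near \<open>w\<close>, simultaneously for the finitely many states and actions.
\<close>

lemma eventually_greedy_subset: "\<forall>\<^sub>F v in nhds w. greedy v \<subseteq> greedy w"
proof -
  have tendsto: "(f \<longlongrightarrow> f w) (nhds w)" if "continuous_on UNIV f" for f :: "real ^ 'n \<Rightarrow> real"
    using that by (auto simp: continuous_on_eq_continuous_at isCont_def tendsto_at_iff_tendsto_nhds)
  have "\<forall>\<^sub>F v in nhds w. D w $ i < action_value w i a \<longrightarrow> D v $ i < action_value v i a" for i a
  proof (cases "D w $ i < action_value w i a")
    case True
    have "((\<lambda>v. action_value v i a - D v $ i) \<longlongrightarrow> action_value w i a - D w $ i) (nhds w)"
      by (intro tendsto continuous_intros continuous_on_action_value continuous_on_bellman)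
    from order_tendstoD(1)[OF this, of 0] True show ?thesis
      by (auto elim: eventually_mono)
  qed simp
  then have "\<forall>\<^sub>F v in nhds w. \<forall>i a. D w $ i < action_value w i a \<longrightarrow> D v $ i < action_value v i a"
    by (intro eventually_all_finite)
  then show ?thesis
    by (rule eventually_mono)
      (auto simp: greedy_iff policies_def, metis bellman_le less_irrefl order.order_iff_strict)
qed

end

section \<open>Linearization at a nearby point\<close>

locale risk_averse_newton = risk_averse_mdp adm \<gamma> R P g risk env
  for adm :: "'n::finite \<Rightarrow> 'm::finite set" and \<gamma> R P g risk env +
  fixes Q :: "real ^ 'n \<Rightarrow> ('n \<Rightarrow> 'm) \<Rightarrow> real ^ 'n ^ 'n"
  assumes selection: "worst_case_selection adm P env Q"
begin

lemma row_maximizes: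
  assumes "\<pi> \<in> policies adm"
  shows "is_arg_max (\<lambda>q. v \<bullet> q) (\<lambda>q. q \<in> env (P i (\<pi> i))) (row i (Q v \<pi>))"
proof -
  have "is_arg_max (\<lambda>q. q \<bullet> v) (\<lambda>q. q \<in> env (P i (\<pi> i))) (row i (Q v \<pi>))"
    using selection assms unfolding worst_case_selection_def by blast
  then show ?thesis unfolding is_arg_max_def by (metis inner_commute)
qed

lemma row_in_simplex:
  assumes "\<pi> \<in> policies adm"
  shows "row i (Q v \<pi>) \<in> prob_simplex"
proof -
  have "row i (Q v \<pi>) \<in> env (P i (\<pi> i))"
    using row_maximizes[OF assms] by (simp add: is_arg_max_def)
  moreover have "env (P i (\<pi> i)) \<subseteq> prob_simplex"
    using envelope[of i "\<pi> i"] by (simp add: risk_envelope_def)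
  ultimately show ?thesis by blast
qed

lemma linearized_operator_nth:
  "linearized_operator \<gamma> g Q v \<pi> w $ i = g i (\<pi> i) + \<gamma> * (w \<bullet> row i (Q v \<pi>))"
  by (simp only: linearized_operator_def vector_add_component vector_scaleR_component
      vec_lambda_beta matrix_vector_mult_nth real_scaleR_def)

lemma linearized_fixed_point_ex1:
  assumes "\<pi> \<in> policies adm"
  shows "\<exists>!x. x = linearized_operator \<gamma> g Q v \<pi> x"
  unfolding linearized_operator_def
  by (rule discounted_stochastic_system_ex1[OF row_in_simplex[OF assms] discount])

text \<open>
  A policy \<open>\<pi>\<close> greedy at \<open>v\<close> is also greedy at \<open>w\<close> when \<open>v\<close> is close to \<open>w\<close>, so \<open>D w\<close> can be computed
  with \<open>\<pi>\<close>; only the replacement of the risk by the row chosen at \<open>v\<close> contributes to the error.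
\<close>

lemma linearized_operator_error:
  assumes "0 < \<epsilon>"
  shows "\<forall>\<^sub>F v in nhds w. \<forall>\<pi>\<in>greedy v.
           infnorm (linearized_operator \<gamma> g Q v \<pi> w - D w) \<le> \<epsilon> * norm (v - w)"
proof -
  have "\<forall>\<^sub>F v in nhds w. \<forall>i a q. is_arg_max (\<lambda>q. v \<bullet> q) (\<lambda>q. q \<in> env (P i a)) q \<longrightarrow>
      risk w (P i a) - w \<bullet> q \<le> \<epsilon> * norm (v - w)"
    by (intro eventually_all_finite risk_linearization_error envelope assms)
  with eventually_greedy_subset[of w] show ?thesis
  proof (eventually_elim, intro ballI infnorm_le_cart)
    fix v \<pi> i
    assume "greedy v \<subseteq> greedy w" and \<pi>: "\<pi> \<in> greedy v"
      and err: "\<forall>i a q. is_arg_max (\<lambda>q. v \<bullet> q) (\<lambda>q. q \<in> env (P i a)) q \<longrightarrow>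
        risk w (P i a) - w \<bullet> q \<le> \<epsilon> * norm (v - w)"
    then have "\<pi> \<in> greedy w" by blast
    then have Dw: "D w $ i = g i (\<pi> i) + \<gamma> * risk w (P i (\<pi> i))"
      by (simp add: greedy_iff action_value_def)
    have adm: "\<pi> \<in> policies adm" using \<pi> by (simp add: greedy_iff)
    note max = row_maximizes[OF this, where v = v and i = i]
    let ?e = "risk w (P i (\<pi> i)) - w \<bullet> row i (Q v \<pi>)"
    have "0 \<le> ?e"
      using inner_le_risk[OF envelope[of i "\<pi> i"]] max by (simp add: is_arg_max_def)
    moreover have "?e \<le> \<epsilon> * norm (v - w)" using err max by blast
    moreover have "(linearized_operator \<gamma> g Q v \<pi> w - D w) $ i = - (\<gamma> * ?e)"
      by (simp add: linearized_operator_nth Dw algebra_simps)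
    ultimately show "\<bar>(linearized_operator \<gamma> g Q v \<pi> w - D w) $ i\<bar> \<le> \<epsilon> * norm (v - w)"
      using discount mult_left_le_one_le[of ?e \<gamma>] by (simp add: abs_mult)
  qed
qed

lemma newton_step_error:
  assumes "0 < c"
  shows "\<forall>\<^sub>F v in nhds v_opt. \<forall>x. (\<exists>\<pi>\<in>greedy v. x = linearized_operator \<gamma> g Q v \<pi> x) \<longrightarrow>
           norm (x - v_opt) \<le> c * norm (v - v_opt)"
proof -
  define d where "d = sqrt (real DIM(real ^ 'n))"
  have "0 < d" by (simp add: d_def)
  \<comment> \<open>The factor \<open>1 - \<gamma>\<close> pays for inverting the linear system, \<open>d\<close> for passing from the
    infinity norm back to the Euclidean norm.\<close>
  define \<epsilon> where "\<epsilon> = c * (1 - \<gamma>) / d"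
  have "0 < \<epsilon>" using assms discount \<open>0 < d\<close> by (simp add: \<epsilon>_def)
  from linearized_operator_error[OF this, of v_opt] show ?thesis
  proof (rule eventually_mono, intro allI impI, elim bexE)
    fix v x \<pi>
    assume err: "\<forall>\<pi>\<in>greedy v.
        infnorm (linearized_operator \<gamma> g Q v \<pi> v_opt - D v_opt) \<le> \<epsilon> * norm (v - v_opt)"
      and \<pi>: "\<pi> \<in> greedy v" and x: "x = linearized_operator \<gamma> g Q v \<pi> x"
    from \<pi> have "\<pi> \<in> policies adm" by (simp add: greedy_iff)
    from discounted_stochastic_perturbation[OF row_in_simplex[OF this] discount(1)
        x[unfolded linearized_operator_def], of v_opt]
    have "(1 - \<gamma>) * infnorm (x - v_opt)
        \<le> infnorm (linearized_operator \<gamma> g Q v \<pi> v_opt - D v_opt)"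
      by (simp only: linearized_operator_def bellman_optimal_value)
    also have "\<dots> \<le> \<epsilon> * norm (v - v_opt)" using err \<pi> by blast
    finally have "(1 - \<gamma>) * infnorm (x - v_opt) \<le> \<epsilon> * norm (v - v_opt)" .
    then have "(1 - \<gamma>) * (d * infnorm (x - v_opt)) \<le> (1 - \<gamma>) * (c * norm (v - v_opt))"
      using \<open>0 < d\<close> by (simp add: \<epsilon>_def pos_le_divide_eq ac_simps)
    then have "d * infnorm (x - v_opt) \<le> c * norm (v - v_opt)"
      using discount by (simp add: mult_le_cancel_left_pos)
    then show "norm (x - v_opt) \<le> c * norm (v - v_opt)"
      using norm_le_infnorm[of "x - v_opt"] by (simp add: d_def)
  qed
qed

section \<open>Iterates and their convergence\<close>

lemma snm3_iterates_ex1: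
  assumes choice: "\<And>k u. choice k u \<in> greedy u"
  shows "\<exists>!v. v 0 = v0 \<and> snm3 adm \<gamma> P g risk Q (\<lambda>k. choice k (v k)) v"
proof -
  \<comment> \<open>The implicit equation for the next iterate is equivalent to an explicit recursion, because it
    has exactly one solution.\<close>
  define solves where "solves k u x \<longleftrightarrow> x = linearized_operator \<gamma> g Q u (choice k u) x" for k u x
  have "\<exists>!x. solves k u x" for k u
    unfolding solves_def
    using choice[of k u] by (intro linearized_fixed_point_ex1) (simp add: greedy_iff)
  then obtain next_iterate where step: "\<And>k u x. solves k u x \<longleftrightarrow> x = next_iterate k u"
    by metis
  have "snm3 adm \<gamma> P g risk Q (\<lambda>k. choice k (v k)) v \<longleftrightarrow>
      (\<forall>k. solves k (v k) (v (Suc k)))" for v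
    by (simp only: snm3_def choice solves_def simp_thms)
  then have "snm3 adm \<gamma> P g risk Q (\<lambda>k. choice k (v k)) v \<longleftrightarrow>
      (\<forall>k. v (Suc k) = next_iterate k (v k))" for v
    by (simp only: step)
  moreover have "\<exists>!v. v 0 = v0 \<and> (\<forall>k. v (Suc k) = next_iterate k (v k))"
  proof (rule ex1I)
    show "rec_nat v0 next_iterate 0 = v0 \<and>
        (\<forall>k. rec_nat v0 next_iterate (Suc k) = next_iterate k (rec_nat v0 next_iterate k))"
      by simp
    fix v assume v: "v 0 = v0 \<and> (\<forall>k. v (Suc k) = next_iterate k (v k))"
    show "v = rec_nat v0 next_iterate"
    proof
      fix k show "v k = rec_nat v0 next_iterate k" by (induction k) (simp_all add: v)
    qed
  qed
  ultimately show ?thesis by simp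
qed

end

text \<open>
  The error bound with \<open>c = 1/2\<close> holds on a ball; the iterates stay in it and converge geometrically.
  Once they converge, the bound for any other \<open>c\<close> applies from some index on. The step is a relation
  so that the result covers every choice of greedy policies at once.
\<close>

lemma Q_superlinear_if_step_error:
  fixes l :: "'a::real_normed_vector" and step :: "'a \<Rightarrow> 'a \<Rightarrow> bool"
  assumes err: "\<And>c. 0 < c \<Longrightarrow>
      \<forall>\<^sub>F v in nhds l. \<forall>x. step v x \<longrightarrow> norm (x - l) \<le> c * norm (v - l)"
  shows "\<exists>U. open U \<and> l \<in> U \<and>
      (\<forall>v. v 0 \<in> U \<longrightarrow> (\<forall>k. step (v k) (v (Suc k))) \<longrightarrow> Q_superlinear v l)"
proof -
  have "\<forall>\<^sub>F v in nhds l. \<forall>x. step v x \<longrightarrow> norm (x - l) \<le> 1/2 * norm (v - l)"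
    by (rule err) simp
  then obtain \<delta> where \<delta>: "0 < \<delta>"
    "\<And>v x. norm (v - l) < \<delta> \<Longrightarrow> step v x \<Longrightarrow> norm (x - l) \<le> 1/2 * norm (v - l)"
    unfolding eventually_nhds_metric dist_norm by blast
  have "Q_superlinear v l" if v0: "v 0 \<in> ball l \<delta>" and step: "\<And>k. step (v k) (v (Suc k))" for v
  proof -
    have bound: "norm (v k - l) < \<delta> \<and> norm (v k - l) \<le> (1/2) ^ k * norm (v 0 - l)" for k
    proof (induction k)
      case 0
      then show ?case using v0 by (simp add: dist_norm norm_minus_commute)
    next
      case (Suc k)
      then have "norm (v (Suc k) - l) \<le> 1/2 * norm (v k - l)" using \<delta>(2) step by blast
      moreover have "0 \<le> norm (v k - l)" by simp
      ultimately have "norm (v (Suc k) - l) < \<delta>"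
          and "norm (v (Suc k) - l) \<le> 1/2 * ((1/2) ^ k * norm (v 0 - l))"
        using Suc.IH by linarith+
      then show ?case by simp
    qed
    have "(\<lambda>k. (1/2) ^ k * norm (v 0 - l)) \<longlonglongrightarrow> 0"
      by (intro tendsto_mult_left_zero LIMSEQ_realpow_zero) auto
    then have "(\<lambda>k. v k - l) \<longlonglongrightarrow> 0"
      using bound by (intro Lim_null_comparison[of "\<lambda>k. v k - l"]) (auto intro: always_eventually)
    then have lim: "v \<longlonglongrightarrow> l" by (simp add: LIM_zero_iff)
    have "\<forall>\<^sub>F k in sequentially. norm (v (Suc k) - l) \<le> c * norm (v k - l)" if "0 < c" for c
      using eventually_compose_filterlim[OF err[OF that] lim] step by (auto elim: eventually_mono)
    with lim show ?thesis by (simp add: Q_superlinear_def)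
  qed
  then show ?thesis using \<delta>(1) by (intro exI[of _ "ball l \<delta>"]) auto
qed

theorem theorem8:
  fixes adm :: "'n::finite \<Rightarrow> 'm::finite set"
    and \<gamma> R :: real
    and P :: "'n \<Rightarrow> 'm \<Rightarrow> real ^ 'n"
    and g :: "'n \<Rightarrow> 'm \<Rightarrow> real"
    and risk :: "real ^ 'n \<Rightarrow> real ^ 'n \<Rightarrow> real"
    and env :: "real ^ 'n \<Rightarrow> (real ^ 'n) set"
    and Q :: "real ^ 'n \<Rightarrow> ('n \<Rightarrow> 'm) \<Rightarrow> real ^ 'n ^ 'n"
  assumes "\<And>i. adm i \<noteq> {}"
    and "0 < \<gamma>" and "\<gamma> < 1"
    and "\<And>i a. P i a \<in> prob_simplex"
    and "0 < R" and "\<And>i a. g i a \<in> {- R..R}"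
    and "\<And>i a. risk_envelope risk (P i a) (env (P i a))"
    and "worst_case_selection adm P env Q"
  shows "(\<forall>v0. \<exists>pol v. v 0 = v0 \<and> snm3 adm \<gamma> P g risk Q pol v) \<and>
         (\<forall>v0. \<forall>extract :: nat \<Rightarrow> real ^ 'n \<Rightarrow> 'n \<Rightarrow> 'm.
            (\<forall>k u. extract k u \<in> greedy_policies adm \<gamma> P g risk u) \<longrightarrow>
            (\<exists>!v. v 0 = v0 \<and> snm3 adm \<gamma> P g risk Q (\<lambda>k. extract k (v k)) v)) \<and>
         ((\<forall>p\<in>prob_simplex. PC1 (\<lambda>v. risk v p)) \<longrightarrow>
            (\<exists>U. open U \<and> optimal_value adm \<gamma> P g risk \<in> U \<and>
               (\<forall>v0\<in>U. \<forall>pol v. v 0 = v0 \<and> snm3 adm \<gamma> P g risk Q pol v \<longrightarrow>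
                  Q_superlinear v (optimal_value adm \<gamma> P g risk))))"
proof -
  interpret risk_averse_newton adm \<gamma> R P g risk env Q
    using assms by unfold_locales (auto simp: abs_le_iff minus_le_iff)
  show ?thesis
  proof (intro conjI allI impI)
    fix v0
    have "\<forall>u. \<exists>\<pi>. \<pi> \<in> greedy u" using greedy_nonempty by blast
    then obtain choice where "\<And>u. choice u \<in> greedy u" unfolding choice_iff by blast
    then have "\<exists>!v. v 0 = v0 \<and> snm3 adm \<gamma> P g risk Q (\<lambda>k. choice (v k)) v"
      by (intro snm3_iterates_ex1)
    then show "\<exists>pol v. v 0 = v0 \<and> snm3 adm \<gamma> P g risk Q pol v" by blast
  next
    fix v0 and choice :: "nat \<Rightarrow> real ^ 'n \<Rightarrow> 'n \<Rightarrow> 'm"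
    assume "\<forall>k u. choice k u \<in> greedy u"
    then show "\<exists>!v. v 0 = v0 \<and> snm3 adm \<gamma> P g risk Q (\<lambda>k. choice k (v k)) v"
      by (intro snm3_iterates_ex1) blast
  next
    show "\<exists>U. open U \<and> v_opt \<in> U \<and>
        (\<forall>v0\<in>U. \<forall>pol v. v 0 = v0 \<and> snm3 adm \<gamma> P g risk Q pol v \<longrightarrow> Q_superlinear v v_opt)"
    proof -
      define step where "step u x \<longleftrightarrow> (\<exists>\<pi>\<in>greedy u. x = linearized_operator \<gamma> g Q u \<pi> x)" for u x
      obtain U where U: "open U" "v_opt \<in> U"
        "\<And>v. v 0 \<in> U \<Longrightarrow> (\<And>k. step (v k) (v (Suc k))) \<Longrightarrow> Q_superlinear v v_opt"
        using Q_superlinear_if_step_error[of step v_opt] newton_step_error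
        unfolding step_def by blast
      have "step (v k) (v (Suc k))" if "snm3 adm \<gamma> P g risk Q pol v" for pol v k
        using that unfolding snm3_def step_def by blast
      with U show ?thesis by blast
    qed
  qed
qed

end
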